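(* Let $(X,r)$ be a finite solution of the Yang--Baxter equation (that is, $X$ is a finite non-empty set and $r$ is a non-degenerate involutive set-theoretic solution on $X$). If the structure group $G(X,r)$ is an Engel group, then $(X,r)$ is the trivial solution, i.e. $r(x,y)=(y,x)$ for all $x,y\in X$.
   Context: Let $X$ be a non-empty set. A map $r\colon X\times X\to X\times X$ is a set-theoretic solution of the Yang--Baxter equation if $r_{12}r_{23}r_{12}=r_{23}r_{12}r_{23}$ on $X\times X\times X$, where $r_{12}=r\times \mathrm{id}_X$ and $r_{23}=\mathrm{id}_X\times r$. Write $r(x,y)=({}^{x}y,x^{y})$. The map $r$ is non-degenerate if for every $x\in X$ the maps $y\mapsto {}^{x}y$ and $y\mapsto y^{x}$ from $X$ to $X$ are bijective, and involutive if $r^2=\mathrm{id}_{X^2}$. By a solution $(X,r)$ of the Yang--Baxter equation is meant a non-degenerate involutive set-theoretic solution. The solution is trivial if $r(x,y)=(y,x)$ for all $x,y\in X$. The structure group of $(X,r)$ is the group with presentation $G(X,r)=\langle X\mid xy=({}^{x}y)(x^{y}),\ x,y\in X\rangle$. For elements $g,h$ of a group, $[g,h]=g^{-1}h^{-1}gh$. A group $G$ is an Engel group if for each $g,h\in G$ there is a positive integer $n(g,h)$ such that $[[\dots[[g,h],h]\dots],h]=1$, where $h$ occurs $n(g,h)$ times. *)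

theory Defs
  imports "HOL-Algebra.Generated_Groups"
begin

section \<open>Set-theoretic solutions of the Yang--Baxter equation\<close>

definition lact :: "('a \<times> 'a \<Rightarrow> 'a \<times> 'a) \<Rightarrow> 'a \<Rightarrow> 'a \<Rightarrow> 'a" where
  "lact r x y = fst (r (x, y))"

definition ract :: "('a \<times> 'a \<Rightarrow> 'a \<times> 'a) \<Rightarrow> 'a \<Rightarrow> 'a \<Rightarrow> 'a" where
  "ract r x y = snd (r (x, y))"

definition r12 :: "('a \<times> 'a \<Rightarrow> 'a \<times> 'a) \<Rightarrow> 'a \<times> 'a \<times> 'a \<Rightarrow> 'a \<times> 'a \<times> 'a" where
  "r12 r = (\<lambda>(x, y, z). (lact r x y, ract r x y, z))"

definition r23 :: "('a \<times> 'a \<Rightarrow> 'a \<times> 'a) \<Rightarrow> 'a \<times> 'a \<times> 'a \<Rightarrow> 'a \<times> 'a \<times> 'a" where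
  "r23 r = (\<lambda>(x, y, z). (x, lact r y z, ract r y z))"

definition set_theoretic_solution :: "'a set \<Rightarrow> ('a \<times> 'a \<Rightarrow> 'a \<times> 'a) \<Rightarrow> bool" where
  "set_theoretic_solution X r \<longleftrightarrow>
     X \<noteq> {} \<and> r \<in> X \<times> X \<rightarrow> X \<times> X \<and>
     (\<forall>t \<in> X \<times> X \<times> X. (r12 r \<circ> r23 r \<circ> r12 r) t = (r23 r \<circ> r12 r \<circ> r23 r) t)"

definition non_degenerate :: "'a set \<Rightarrow> ('a \<times> 'a \<Rightarrow> 'a \<times> 'a) \<Rightarrow> bool" where
  "non_degenerate X r \<longleftrightarrow>
     (\<forall>x \<in> X. bij_betw (\<lambda>y. lact r x y) X X \<and> bij_betw (\<lambda>y. ract r y x) X X)"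

definition involutive :: "'a set \<Rightarrow> ('a \<times> 'a \<Rightarrow> 'a \<times> 'a) \<Rightarrow> bool" where
  "involutive X r \<longleftrightarrow> (\<forall>p \<in> X \<times> X. r (r p) = p)"

definition ybe_solution :: "'a set \<Rightarrow> ('a \<times> 'a \<Rightarrow> 'a \<times> 'a) \<Rightarrow> bool" where
  "ybe_solution X r \<longleftrightarrow>
     set_theoretic_solution X r \<and> non_degenerate X r \<and> involutive X r"

definition trivial_solution :: "'a set \<Rightarrow> ('a \<times> 'a \<Rightarrow> 'a \<times> 'a) \<Rightarrow> bool" where
  "trivial_solution X r \<longleftrightarrow> (\<forall>x \<in> X. \<forall>y \<in> X. r (x, y) = (y, x))"


section \<open>Groups given by generators and relations\<close>

text \<open>A word is a list of signed letters: \<open>(x, True)\<close> stands for the generator \<open>x\<close> and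
  \<open>(x, False)\<close> for its formal inverse.\<close>

definition group_words :: "'a set \<Rightarrow> ('a \<times> bool) list set" where
  "group_words X = lists (X \<times> UNIV)"

text \<open>The least congruence on the monoid of words over \<open>X\<close> that contains free cancellation and
  the relations \<open>R\<close>; a pair \<open>(l, m) \<in> R\<close> stands for the relation \<open>l = m\<close>.\<close>

inductive word_cong ::
    "'a set \<Rightarrow> (('a \<times> bool) list \<times> ('a \<times> bool) list) set \<Rightarrow>
     ('a \<times> bool) list \<Rightarrow> ('a \<times> bool) list \<Rightarrow> bool"
  for X R where
  refl: "w \<in> group_words X \<Longrightarrow> word_cong X R w w"
| sym: "word_cong X R u v \<Longrightarrow> word_cong X R v u"
| trans: "word_cong X R u v \<Longrightarrow> word_cong X R v w \<Longrightarrow> word_cong X R u w"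
| append: "word_cong X R u u' \<Longrightarrow> word_cong X R v v' \<Longrightarrow> word_cong X R (u @ v) (u' @ v')"
| cancel: "x \<in> X \<Longrightarrow> word_cong X R [(x, b), (x, \<not> b)] []"
| rel: "(l, m) \<in> R \<Longrightarrow> l \<in> group_words X \<Longrightarrow> m \<in> group_words X \<Longrightarrow> word_cong X R l m"

definition word_class ::
    "'a set \<Rightarrow> (('a \<times> bool) list \<times> ('a \<times> bool) list) set \<Rightarrow>
     ('a \<times> bool) list \<Rightarrow> ('a \<times> bool) list set" where
  "word_class X R w = {v. word_cong X R w v}"

definition presented_group ::
    "'a set \<Rightarrow> (('a \<times> bool) list \<times> ('a \<times> bool) list) set \<Rightarrow> ('a \<times> bool) list set monoid" where
  "presented_group X R =
     \<lparr> carrier = word_class X R ` group_words X,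
       monoid.mult = (\<lambda>A B. {w. \<exists>u \<in> A. \<exists>v \<in> B. word_cong X R (u @ v) w}),
       one = word_class X R [] \<rparr>"

definition structure_group :: "'a set \<Rightarrow> ('a \<times> 'a \<Rightarrow> 'a \<times> 'a) \<Rightarrow> ('a \<times> bool) list set monoid" where
  "structure_group X r =
     presented_group X
       {([(x, True), (y, True)], [(lact r x y, True), (ract r x y, True)]) | x y. x \<in> X \<and> y \<in> X}"


section \<open>Engel groups\<close>

definition group_commutator :: "('g, 'b) monoid_scheme \<Rightarrow> 'g \<Rightarrow> 'g \<Rightarrow> 'g" where
  "group_commutator G g h = inv\<^bsub>G\<^esub> g \<otimes>\<^bsub>G\<^esub> inv\<^bsub>G\<^esub> h \<otimes>\<^bsub>G\<^esub> g \<otimes>\<^bsub>G\<^esub> h"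

definition engel_group :: "('g, 'b) monoid_scheme \<Rightarrow> bool" where
  "engel_group G \<longleftrightarrow> group G \<and>
     (\<forall>g \<in> carrier G. \<forall>h \<in> carrier G. \<exists>n > 0.
        ((\<lambda>u. group_commutator G u h) ^^ n) g = \<one>\<^bsub>G\<^esub>)"


section \<open>Basic facts about presented groups\<close>

lemma group_words_simps [simp]:
  "[] \<in> group_words X"
  "u @ v \<in> group_words X \<longleftrightarrow> u \<in> group_words X \<and> v \<in> group_words X"
  "a # u \<in> group_words X \<longleftrightarrow> fst a \<in> X \<and> u \<in> group_words X"
  by (cases a; auto simp: group_words_def)+

lemma word_cong_words:
  "word_cong X R u v \<Longrightarrow> u \<in> group_words X \<and> v \<in> group_words X"
  by (induction rule: word_cong.induct) auto

lemma word_class_eq_iff: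
  assumes "u \<in> group_words X"
  shows "word_class X R u = word_class X R v \<longleftrightarrow> word_cong X R u v"
proof
  assume "word_class X R u = word_class X R v"
  then show "word_cong X R u v"
    using word_cong.refl[OF assms, of R] word_cong.sym
    unfolding word_class_def by blast
next
  assume "word_cong X R u v"
  then show "word_class X R u = word_class X R v"
    unfolding word_class_def using word_cong.sym word_cong.trans by blast
qed

lemma presented_group_carrier:
  "carrier (presented_group X R) = word_class X R ` group_words X"
  by (simp add: presented_group_def)

lemma presented_group_one:
  "\<one>\<^bsub>presented_group X R\<^esub> = word_class X R []"
  by (simp add: presented_group_def)

lemma presented_group_mult:
  assumes "u \<in> group_words X" "v \<in> group_words X"
  shows "word_class X R u \<otimes>\<^bsub>presented_group X R\<^esub> word_class X R v = word_class X R (u @ v)"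
proof (intro Set.set_eqI iffI)
  fix w
  assume "w \<in> word_class X R u \<otimes>\<^bsub>presented_group X R\<^esub> word_class X R v"
  then obtain u' v' where "word_cong X R u u'" "word_cong X R v v'" "word_cong X R (u' @ v') w"
    by (auto simp: presented_group_def word_class_def)
  then show "w \<in> word_class X R (u @ v)"
    unfolding word_class_def using word_cong.append word_cong.trans by blast
next
  fix w
  assume "w \<in> word_class X R (u @ v)"
  then show "w \<in> word_class X R u \<otimes>\<^bsub>presented_group X R\<^esub> word_class X R v"
    using word_cong.refl[OF assms(1), of R] word_cong.refl[OF assms(2), of R]
    by (auto simp: presented_group_def word_class_def)
qed

definition word_inverse :: "('a \<times> bool) list \<Rightarrow> ('a \<times> bool) list" where
  "word_inverse w = rev (map (\<lambda>(x, b). (x, \<not> b)) w)"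

lemma word_inverse_words [simp]:
  "w \<in> group_words X \<Longrightarrow> word_inverse w \<in> group_words X"
  unfolding word_inverse_def by (induction w) auto

lemma word_inverse_cong:
  assumes "w \<in> group_words X"
  shows "word_cong X R (word_inverse w @ w) []"
  using assms
proof (induction w)
  case Nil
  then show ?case by (simp add: word_inverse_def word_cong.refl)
next
  case (Cons a w)
  obtain x b where a: "a = (x, b)" by fastforce
  have x: "x \<in> X" and w: "w \<in> group_words X" using Cons.prems a by auto
  have "word_cong X R ([(x, \<not> b), (x, b)] @ w) ([] @ w)"
    using word_cong.append[OF word_cong.cancel[OF x, of R "\<not> b"] word_cong.refl[OF w]] by simp
  then have "word_cong X R (word_inverse w @ [(x, \<not> b), (x, b)] @ w) (word_inverse w @ w)"
    using word_cong.append[OF word_cong.refl[OF word_inverse_words[OF w]]] by fastforce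
  then have "word_cong X R (word_inverse (a # w) @ a # w) (word_inverse w @ w)"
    by (simp add: word_inverse_def a)
  then show ?case using Cons.IH[OF w] word_cong.trans by blast
qed

lemma group_presented_group: "group (presented_group X R)"
proof (rule groupI)
  fix A assume "A \<in> carrier (presented_group X R)"
  then obtain w where w: "w \<in> group_words X" "A = word_class X R w"
    by (auto simp: presented_group_carrier)
  have "word_class X R (word_inverse w) \<otimes>\<^bsub>presented_group X R\<^esub> A = \<one>\<^bsub>presented_group X R\<^esub>"
    using w by (simp add: presented_group_mult presented_group_one word_class_eq_iff word_inverse_cong)
  then show "\<exists>B \<in> carrier (presented_group X R). B \<otimes>\<^bsub>presented_group X R\<^esub> A = \<one>\<^bsub>presented_group X R\<^esub>"
    using w by (auto simp: presented_group_carrier)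
qed (auto simp: presented_group_carrier presented_group_one presented_group_mult)

lemma presented_group_relation:
  assumes "(l, m) \<in> R" "l \<in> group_words X" "m \<in> group_words X"
  shows "word_class X R l = word_class X R m"
  using assms by (simp add: word_class_eq_iff word_cong.rel)

fun eval_word :: "('g, 'b) monoid_scheme \<Rightarrow> ('a \<Rightarrow> 'g) \<Rightarrow> ('a \<times> bool) list \<Rightarrow> 'g" where
  "eval_word H f [] = \<one>\<^bsub>H\<^esub>"
| "eval_word H f ((x, b) # w) = (if b then f x else inv\<^bsub>H\<^esub> (f x)) \<otimes>\<^bsub>H\<^esub> eval_word H f w"

text \<open>The universal property, split into existence of the induced homomorphism and the fact that
  a homomorphism is determined by its values on the generators.\<close>

lemma presented_group_hom_exists:
  assumes H: "group H" and f: "f \<in> X \<rightarrow> carrier H"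
    and R: "\<And>l m. (l, m) \<in> R \<Longrightarrow> eval_word H f l = eval_word H f m"
  shows "\<exists>\<phi> \<in> hom (presented_group X R) H. \<forall>x \<in> X. \<phi> (word_class X R [(x, True)]) = f x"
proof -
  interpret H: group H by fact
  have closed: "eval_word H f w \<in> carrier H" if "w \<in> group_words X" for w
    using that f by (induction w) (auto simp: Pi_iff intro!: H.m_closed H.inv_closed)
  have app: "eval_word H f (u @ v) = eval_word H f u \<otimes>\<^bsub>H\<^esub> eval_word H f v"
    if "u \<in> group_words X" "v \<in> group_words X" for u v
    using that(1)
  proof (induction u)
    case Nil
    then show ?case using closed[OF that(2)] by simp
  next
    case (Cons a u)
    then show ?case using closed[of u] closed[OF that(2)] f
      by (cases a) (auto simp: H.m_assoc Pi_iff)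
  qed
  have resp: "eval_word H f u = eval_word H f v" if "word_cong X R u v" for u v
    using that
  proof (induction rule: word_cong.induct)
    case (append u u' v v')
    then show ?case by (simp add: app word_cong_words)
  next
    case (cancel x b)
    then show ?case using f by (auto simp: Pi_iff)
  qed (simp_all add: R)
  define \<phi> where "\<phi> A = eval_word H f (SOME w. w \<in> A)" for A
  have \<phi>: "\<phi> (word_class X R w) = eval_word H f w" if "w \<in> group_words X" for w
  proof -
    have "word_cong X R w (SOME v. v \<in> word_class X R w)"
      using someI[of "\<lambda>v. v \<in> word_class X R w" w] word_cong.refl[OF that]
      by (simp add: word_class_def)
    then show ?thesis using resp by (simp add: \<phi>_def)
  qed
  have "\<phi> \<in> hom (presented_group X R) H"
    by (rule homI) (auto simp: presented_group_carrier presented_group_mult \<phi> closed app)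
  moreover have "\<forall>x \<in> X. \<phi> (word_class X R [(x, True)]) = f x"
    using f by (auto simp: \<phi> Pi_iff)
  ultimately show ?thesis by blast
qed

lemma presented_group_hom_unique:
  assumes H: "group H"
    and \<phi>: "\<phi> \<in> hom (presented_group X R) H" and \<psi>: "\<psi> \<in> hom (presented_group X R) H"
    and eq: "\<And>x. x \<in> X \<Longrightarrow> \<phi> (word_class X R [(x, True)]) = \<psi> (word_class X R [(x, True)])"
    and A: "A \<in> carrier (presented_group X R)"
  shows "\<phi> A = \<psi> A"
proof -
  let ?G = "presented_group X R"
  interpret G: group ?G by (rule group_presented_group)
  interpret f: group_hom ?G H \<phi> using H \<phi> G.is_group by (simp add: group_hom_def group_hom_axioms_def)
  interpret g: group_hom ?G H \<psi> using H \<psi> G.is_group by (simp add: group_hom_def group_hom_axioms_def)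
  have letter: "\<phi> (word_class X R [(x, b)]) = \<psi> (word_class X R [(x, b)])" if x: "x \<in> X" for x b
  proof (cases b)
    case True
    then show ?thesis using eq x by simp
  next
    case False
    have c: "word_class X R [(x, True)] \<in> carrier ?G" "word_class X R [(x, False)] \<in> carrier ?G"
      using x by (auto simp: presented_group_carrier)
    have "word_class X R [(x, False)] \<otimes>\<^bsub>?G\<^esub> word_class X R [(x, True)] = \<one>\<^bsub>?G\<^esub>"
      using x word_cong.cancel[OF x, of R False]
      by (simp add: presented_group_mult presented_group_one word_class_eq_iff)
    then have "inv\<^bsub>?G\<^esub> word_class X R [(x, True)] = word_class X R [(x, False)]"
      using c G.inv_equality by blast
    then show ?thesis using False c eq[OF x] f.hom_inv g.hom_inv by metis
  qed
  obtain w where w: "w \<in> group_words X" "A = word_class X R w"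
    using A by (auto simp: presented_group_carrier)
  have "\<phi> (word_class X R w) = \<psi> (word_class X R w)"
    using w(1)
  proof (induction w)
    case Nil
    then show ?case using f.hom_one g.hom_one by (simp add: presented_group_one)
  next
    case (Cons a w)
    obtain x b where a: "a = (x, b)" by fastforce
    have x: "x \<in> X" and w: "w \<in> group_words X" using Cons.prems a by auto
    have m: "word_class X R (a # w) = word_class X R [a] \<otimes>\<^bsub>?G\<^esub> word_class X R w"
      using x w a by (simp add: presented_group_mult)
    have "word_class X R [a] \<in> carrier ?G" "word_class X R w \<in> carrier ?G"
      using x w a by (auto simp: presented_group_carrier)
    then show ?case using m letter[OF x, of b] Cons.IH[OF w] a by simp
  qed
  then show ?thesis using w by simp
qed

end

theory Submission
  imports Defs "HOL-Combinatorics.Cycles"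
begin

text \<open>
  The structure group acts on the lattice \<open>\<int>\<^sup>X\<close> by affine maps: the generator \<open>x\<close> acts as the
  permutation \<open>\<sigma>\<^sub>x: y \<mapsto> lact r x y\<close> of the coordinates followed by the translation by the unit vector
  \<open>e\<^sub>x\<close> (lemma \<open>structure_group_hom\<close>).  The proof plays the translations in the image of this
  action against its linear parts.

  \<^item> For every \<open>x\<close> the image contains a pure translation by a nonzero multiple of \<open>e\<^sub>x\<close>
    (\<open>pure_translation_exists\<close>).  Indeed a pair with translation part \<open>k e\<^sub>x\<close> can always be
    multiplied by a suitable generator to give one with translation part \<open>(k + 1) e\<^sub>x\<close>.  Since \<open>X\<close> has
    only finitely many permutations, two of the pairs obtained have the same linear part,
    and their quotient is a pure translation.

  \<^item> The commutator of a pure translation by \<open>v\<close> with an affine map of linear part \<open>\<sigma>\<close> is the pure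
    translation by the difference of \<open>v\<close> and a permuted copy of it, and repeated commutators iterate
    this difference operator (\<open>iterated_commutator_translation\<close>).  A permutation of finite order
    is semisimple in characteristic zero, so if an iterated difference of \<open>v\<close> vanishes, then
    already \<open>v\<close> itself is invariant (\<open>iterated_difference_zero_imp_invariant\<close>).

  If the structure group is Engel, then by these two facts every \<open>\<sigma>\<^sub>z\<close> fixes a nonzero multiple
  of each \<open>e\<^sub>x\<close>, hence fixes \<open>x\<close>.  So \<open>r (x, y)\<close> has first component \<open>y\<close>, and involutivity
  then determines the second one.
\<close>

text \<open>The inverse function, since plain \<open>inv\<close> is the notation for inverses in a group.\<close>

abbreviation perm_inv :: "('a \<Rightarrow> 'a) \<Rightarrow> 'a \<Rightarrow> 'a" where
  "perm_inv s \<equiv> inv_into UNIV s"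

section \<open>Affine maps of the lattice with permutations as linear parts\<close>

text \<open>The semidirect product of the lattice and the symmetric group of \<open>X\<close>.  Lattice vectors are
  functions on the whole type, whose coordinates outside \<open>X\<close> stay in place under the linear
  parts.  The pair \<open>(v, s)\<close> is the affine map \<open>u \<mapsto> v + u \<circ> s\<close>; so the
  linear part that moves \<open>e\<^sub>y\<close> to \<open>e\<^bsub>\<sigma> y\<^esub>\<close> is stored as \<open>s = \<sigma>\<^sup>-\<^sup>1\<close>, which spares the group law any
  inverse.\<close>

definition affine_perm_group :: "'a set \<Rightarrow> (('a \<Rightarrow> int) \<times> ('a \<Rightarrow> 'a)) monoid" where
  "affine_perm_group X =
     \<lparr> carrier = {(v, s). s permutes X},
       monoid.mult = (\<lambda>(v, s) (w, t). (\<lambda>z. v z + w (s z), t \<circ> s)),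
       one = (\<lambda>z. 0, id) \<rparr>"

lemma affine_perm_group_simps:
  "(v, s) \<in> carrier (affine_perm_group X) \<longleftrightarrow> s permutes X"
  "(v, s) \<otimes>\<^bsub>affine_perm_group X\<^esub> (w, t) = (\<lambda>z. v z + w (s z), t \<circ> s)"
  "\<one>\<^bsub>affine_perm_group X\<^esub> = (\<lambda>z. 0, id)"
  by (simp_all add: affine_perm_group_def)

lemma group_affine_perm_group: "group (affine_perm_group X)"
proof (rule groupI)
  fix g assume "g \<in> carrier (affine_perm_group X)"
  then obtain v s where g: "g = (v, s)" and s: "s permutes X"
    by (cases g) (auto simp: affine_perm_group_simps)
  have "(\<lambda>z. - v (perm_inv s z), perm_inv s) \<otimes>\<^bsub>affine_perm_group X\<^esub> g = \<one>\<^bsub>affine_perm_group X\<^esub>"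
    using permutes_inv_o[OF s] by (simp add: g affine_perm_group_simps)
  then show "\<exists>h \<in> carrier (affine_perm_group X).
      h \<otimes>\<^bsub>affine_perm_group X\<^esub> g = \<one>\<^bsub>affine_perm_group X\<^esub>"
    using permutes_inv[OF s] by (intro bexI) (auto simp: affine_perm_group_simps)
qed (auto simp: affine_perm_group_simps permutes_id add.assoc comp_assoc intro: permutes_compose)

lemma affine_perm_group_inv:
  assumes "s permutes X"
  shows "inv\<^bsub>affine_perm_group X\<^esub> (v, s) = (\<lambda>z. - v (perm_inv s z), perm_inv s)"
  using assms permutes_inv_o[OF assms]
  by (intro group.inv_equality[OF group_affine_perm_group])
     (auto simp: affine_perm_group_simps permutes_inv)

lemma commutator_translation:
  assumes "s permutes X"
  shows "group_commutator (affine_perm_group X) (v, id) (w, s) = (\<lambda>z. v (perm_inv s z) - v z, id)"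
  using assms permutes_inv_o[OF assms] permutes_inverses[OF assms]
  by (auto simp: group_commutator_def affine_perm_group_simps affine_perm_group_inv permutes_id)

lemma iterated_commutator_translation:
  assumes "s permutes X"
  shows "((\<lambda>u. group_commutator (affine_perm_group X) u (w, s)) ^^ n) (v, id) =
    (((\<lambda>v z. v (perm_inv s z) - v z) ^^ n) v, id)"
proof (induction n)
  case (Suc n)
  show ?case
    unfolding funpow.simps comp_apply Suc commutator_translation[OF assms] ..
qed simp

text \<open>If the second difference of \<open>u\<close> vanishes, then \<open>u\<close> grows linearly along the orbits of \<open>p\<close>.  The
  orbits are finite, so the growth rate, which is the first difference, is zero.  Hence the
  number of differences can be lowered to one.\<close>

lemma iterated_difference_zero_imp_invariant:
  fixes v :: "'a \<Rightarrow> int"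
  assumes d: "d > 0" "p ^^ d = id"
    and zero: "((\<lambda>v z. v (p z) - v z) ^^ n) v = (\<lambda>z. 0)"
  shows "v (p z) = v z"
proof -
  define D :: "('a \<Rightarrow> int) \<Rightarrow> 'a \<Rightarrow> int" where "D = (\<lambda>v z. v (p z) - v z)"
  have drop: "D u = (\<lambda>z. 0)" if u: "D (D u) = (\<lambda>z. 0)" for u
  proof
    fix z
    have inv: "D u (p y) = D u y" for y
      using fun_cong[OF u, of y] by (simp add: D_def)
    have const: "D u ((p ^^ j) z) = D u z" for j
      by (induction j) (simp_all add: inv)
    have "u ((p ^^ j) z) = u z + int j * D u z" for j
    proof (induction j)
      case (Suc j)
      have "u ((p ^^ Suc j) z) = u ((p ^^ j) z) + D u ((p ^^ j) z)" by (simp add: D_def)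
      then show ?case using Suc const by (simp add: algebra_simps)
    qed simp
    from this[of d] have "int d * D u z = 0" using d by simp
    then show "D u z = 0" using d by simp
  qed
  have "D v = (\<lambda>z. 0)"
    using zero unfolding D_def[symmetric]
  proof (induction n)
    case 0
    then show ?case by (simp add: D_def)
  next
    case (Suc n)
    show ?case
    proof (cases n)
      case 0
      then show ?thesis using Suc.prems by simp
    next
      case m: (Suc m)
      have "D ((D ^^ m) v) = (\<lambda>z. 0)"
        by (rule drop) (use Suc.prems m in simp)
      then have "(D ^^ n) v = (\<lambda>z. 0)" by (simp add: m)
      then show ?thesis by (rule Suc.IH)
    qed
  qed
  from fun_cong[OF this, of z] show ?thesis by (simp add: D_def)
qed

section \<open>The action of the structure group on the lattice\<close>

text \<open>The left action extended by the identity outside \<open>X\<close>, so that it is a permutation of the whole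
  type.\<close>

definition lact_perm :: "'a set \<Rightarrow> ('a \<times> 'a \<Rightarrow> 'a \<times> 'a) \<Rightarrow> 'a \<Rightarrow> 'a \<Rightarrow> 'a" where
  "lact_perm X r x y = (if y \<in> X then lact r x y else y)"

definition unit_vector :: "'a \<Rightarrow> 'a \<Rightarrow> int" where
  "unit_vector x z = (if z = x then 1 else 0)"

definition generator_affine ::
    "'a set \<Rightarrow> ('a \<times> 'a \<Rightarrow> 'a \<times> 'a) \<Rightarrow> 'a \<Rightarrow> ('a \<Rightarrow> int) \<times> ('a \<Rightarrow> 'a)" where
  "generator_affine X r x = (unit_vector x, perm_inv (lact_perm X r x))"

lemma unit_vector_inv:
  assumes "bij s"
  shows "unit_vector x (perm_inv s z) = unit_vector (s x) z"
  using bij_inv_eq_iff[OF assms, of x z] by (auto simp: unit_vector_def)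

lemma lact_perm_permutes:
  assumes "non_degenerate X r" "x \<in> X"
  shows "lact_perm X r x permutes X"
proof (rule bij_imp_permutes)
  have "bij_betw (lact r x) X X" using assms by (auto simp: non_degenerate_def)
  then show "bij_betw (lact_perm X r x) X X"
    by (subst bij_betw_cong[of _ _ "lact r x"]) (auto simp: lact_perm_def)
qed (simp add: lact_perm_def)

text \<open>The first component of the Yang--Baxter equation: the linear parts respect the relations of
  the structure group.\<close>

lemma lact_perm_relation:
  assumes "set_theoretic_solution X r" "x \<in> X" "y \<in> X"
  shows "lact_perm X r (lact r x y) \<circ> lact_perm X r (ract r x y) =
    lact_perm X r x \<circ> lact_perm X r y"
proof
  fix z
  have closed: "lact r a b \<in> X" "ract r a b \<in> X" if "a \<in> X" "b \<in> X" for a b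
  proof -
    have "r (a, b) \<in> X \<times> X"
      using assms(1) that by (auto simp: set_theoretic_solution_def)
    then show "lact r a b \<in> X" "ract r a b \<in> X"
      by (auto simp: lact_def ract_def mem_Times_iff)
  qed
  show "(lact_perm X r (lact r x y) \<circ> lact_perm X r (ract r x y)) z =
    (lact_perm X r x \<circ> lact_perm X r y) z"
  proof (cases "z \<in> X")
    case True
    then have "(r12 r \<circ> r23 r \<circ> r12 r) (x, y, z) = (r23 r \<circ> r12 r \<circ> r23 r) (x, y, z)"
      using assms by (simp add: set_theoretic_solution_def)
    then show ?thesis using True closed assms by (simp add: r12_def r23_def lact_perm_def)
  qed (simp add: lact_perm_def)
qed

text \<open>The defining relation \<open>x y = a b\<close>, where \<open>(a, b) = r (x, y)\<close>, holds for the affine maps: the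
  translation parts are \<open>e\<^sub>x + e\<^bsub>\<sigma>\<^sub>x y\<^esub> = e\<^sub>x + e\<^sub>a\<close> and \<open>e\<^sub>a + e\<^bsub>\<sigma>\<^sub>a b\<^esub>\<close>, and
  involutivity says that \<open>\<sigma>\<^sub>a b = x\<close>.\<close>

lemma generator_affine_relation:
  assumes sol: "ybe_solution X r" and x: "x \<in> X" and y: "y \<in> X"
  shows "generator_affine X r x \<otimes>\<^bsub>affine_perm_group X\<^esub> generator_affine X r y =
    generator_affine X r (lact r x y) \<otimes>\<^bsub>affine_perm_group X\<^esub> generator_affine X r (ract r x y)"
proof -
  define a where "a = lact r x y"
  define b where "b = ract r x y"
  have st: "set_theoretic_solution X r" and nd: "non_degenerate X r" and iv: "involutive X r"
    using sol by (auto simp: ybe_solution_def)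
  have rab: "r (x, y) = (a, b)" by (simp add: a_def b_def lact_def ract_def)
  have "r (x, y) \<in> X \<times> X" using st x y by (auto simp: set_theoretic_solution_def)
  then have ab: "a \<in> X" "b \<in> X" using rab by auto
  have "r (a, b) = (x, y)" using iv x y rab by (force simp: involutive_def)
  then have "lact_perm X r a b = x" using ab by (simp add: lact_perm_def lact_def)
  moreover have "lact_perm X r x y = a" using y by (simp add: lact_perm_def a_def)
  moreover have bij: "bij (lact_perm X r u)" if "u \<in> X" for u
    using lact_perm_permutes[OF nd that] by (rule permutes_bij)
  moreover have "perm_inv (lact_perm X r b) \<circ> perm_inv (lact_perm X r a) =
      perm_inv (lact_perm X r y) \<circ> perm_inv (lact_perm X r x)"
    using lact_perm_relation[OF st x y] bij x y ab
    by (simp add: o_inv_distrib[symmetric] a_def b_def)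
  ultimately show ?thesis
    using x y ab
    by (simp add: generator_affine_def affine_perm_group_simps unit_vector_inv add.commute
        flip: a_def b_def)
qed

lemma structure_group_hom:
  assumes "ybe_solution X r"
  shows "\<exists>\<phi> \<in> hom (structure_group X r) (affine_perm_group X).
    generator_affine X r ` X \<subseteq> \<phi> ` carrier (structure_group X r)"
proof -
  let ?R = "{([(x, True), (y, True)], [(lact r x y, True), (ract r x y, True)]) | x y.
    x \<in> X \<and> y \<in> X}"
  interpret H: group "affine_perm_group X" by (rule group_affine_perm_group)
  have nd: "non_degenerate X r" and st: "set_theoretic_solution X r"
    using assms by (auto simp: ybe_solution_def)
  have gen: "generator_affine X r \<in> X \<rightarrow> carrier (affine_perm_group X)"
    using permutes_inv[OF lact_perm_permutes[OF nd]]
    by (simp add: generator_affine_def affine_perm_group_simps)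
  have rel: "eval_word (affine_perm_group X) (generator_affine X r) l =
      eval_word (affine_perm_group X) (generator_affine X r) m" if "(l, m) \<in> ?R" for l m
  proof -
    from that obtain x y where xy: "x \<in> X" "y \<in> X" "l = [(x, True), (y, True)]"
      "m = [(lact r x y, True), (ract r x y, True)]" by auto
    have "r (x, y) \<in> X \<times> X" using st xy by (auto simp: set_theoretic_solution_def)
    then have "lact r x y \<in> X" "ract r x y \<in> X" by (auto simp: lact_def ract_def mem_Times_iff)
    then show ?thesis
      using xy gen generator_affine_relation[OF assms xy(1,2)] by (simp add: Pi_iff)
  qed
  obtain \<phi> where \<phi>: "\<phi> \<in> hom (structure_group X r) (affine_perm_group X)"
    and val: "\<And>x. x \<in> X \<Longrightarrow> \<phi> (word_class X ?R [(x, True)]) = generator_affine X r x"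
    using presented_group_hom_exists[OF group_affine_perm_group gen rel]
    unfolding structure_group_def by blast
  have "word_class X ?R [(x, True)] \<in> carrier (structure_group X r)" if "x \<in> X" for x
    using that by (simp add: structure_group_def presented_group_carrier)
  then have "generator_affine X r ` X \<subseteq> \<phi> ` carrier (structure_group X r)"
    by (metis (no_types, lifting) image_eqI image_subsetI val)
  with \<phi> show ?thesis by blast
qed

text \<open>Multiplying \<open>(k e\<^sub>x, s)\<close> on the right by the generator at \<open>y = s x\<close> adds \<open>e\<^sub>y \<circ> s = e\<^sub>x\<close> to the
  translation part, so every \<open>k e\<^sub>x\<close> occurs as a translation part.  The quotient of two such
  elements with equal linear parts is a pure translation.\<close>

lemma pure_translation_exists:
  assumes fin: "finite X" and x: "x \<in> X"
    and K: "subgroup K (affine_perm_group X)"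
    and gen: "\<And>y. y \<in> X \<Longrightarrow> \<exists>t. (unit_vector y, t) \<in> K"
  shows "\<exists>m. m \<noteq> 0 \<and> (\<lambda>z. m * unit_vector x z, id) \<in> K"
proof -
  interpret K: subgroup K "affine_perm_group X" by (rule K)
  have perm: "s permutes X" if "(v, s) \<in> K" for v s
    using K.mem_carrier[OF that] by (simp add: affine_perm_group_simps)
  have "\<exists>s. (\<lambda>z. int k * unit_vector x z, s) \<in> K" for k
  proof (induction k)
    case 0
    then show ?case using K.one_closed by (auto simp: affine_perm_group_simps)
  next
    case (Suc k)
    then obtain s where s: "(\<lambda>z. int k * unit_vector x z, s) \<in> K" by blast
    have "s x \<in> X" using permutes_in_image[OF perm[OF s]] x by simp
    then obtain t where t: "(unit_vector (s x), t) \<in> K" using gen by blast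
    have "unit_vector (s x) (s z) = unit_vector x z" for z
      using permutes_inj[OF perm[OF s]] by (simp add: unit_vector_def inj_eq)
    then have "(\<lambda>z. int (Suc k) * unit_vector x z, t \<circ> s) \<in> K"
      using K.m_closed[OF s t] by (simp add: affine_perm_group_simps algebra_simps)
    then show ?case by blast
  qed
  then obtain s where s: "\<And>k. (\<lambda>z. int k * unit_vector x z, s k) \<in> K" by metis
  have "finite (range s)"
    using finite_permutations[OF fin] by (rule finite_subset[rotated]) (use perm s in auto)
  \<comment> \<open>Infinitely many \<open>k\<close> share finitely many linear parts.\<close>
  then obtain i j where ij: "i \<noteq> j" "s i = s j"
    using finite_imageD[of s UNIV] infinite_UNIV_nat by (metis inj_on_def)
  have "(\<lambda>z. int j * unit_vector x z, s j) \<otimes>\<^bsub>affine_perm_group X\<^esub>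
      inv\<^bsub>affine_perm_group X\<^esub> (\<lambda>z. int i * unit_vector x z, s i) \<in> K"
    using s by (intro K.m_closed K.m_inv_closed)
  then have "(\<lambda>z. (int j - int i) * unit_vector x z, id) \<in> K"
    using perm[OF s, of j] permutes_inv_o[OF perm[OF s, of j]]
      permutes_inverses[OF perm[OF s, of j]] ij
    by (simp add: affine_perm_group_simps affine_perm_group_inv algebra_simps)
  then show ?thesis using ij by (intro exI[of _ "int j - int i"]) simp
qed

section \<open>Engel structure groups\<close>

lemma hom_iterated_commutator:
  assumes "group_hom G H \<phi>" "g \<in> carrier G" "h \<in> carrier G"
  shows "\<phi> (((\<lambda>u. group_commutator G u h) ^^ n) g) =
    ((\<lambda>u. group_commutator H u (\<phi> h)) ^^ n) (\<phi> g)"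
proof -
  interpret group_hom G H \<phi> by (rule assms(1))
  have "((\<lambda>u. group_commutator G u h) ^^ n) g \<in> carrier G" for n
    by (induction n) (use assms in \<open>auto simp: group_commutator_def\<close>)
  then show ?thesis
    by (induction n) (use assms in \<open>auto simp: group_commutator_def\<close>)
qed

theorem theorem4:
  fixes X :: "'a set" and r :: "'a \<times> 'a \<Rightarrow> 'a \<times> 'a"
  assumes "finite X"
    and "ybe_solution X r"
    and "engel_group (structure_group X r)"
  shows "trivial_solution X r"
proof -
  let ?G = "structure_group X r" and ?H = "affine_perm_group X"
  have nd: "non_degenerate X r" and iv: "involutive X r"
    using assms(2) by (auto simp: ybe_solution_def)
  obtain \<phi> where \<phi>: "\<phi> \<in> hom ?G ?H"
    and gen: "generator_affine X r ` X \<subseteq> \<phi> ` carrier ?G"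
    using structure_group_hom[OF assms(2)] by blast
  interpret group_hom ?G ?H \<phi>
    using \<phi> assms(3) group_affine_perm_group
    by (simp add: group_hom_def group_hom_axioms_def engel_group_def)
  have fixes_all: "lact r z x = x" if z: "z \<in> X" and x: "x \<in> X" for x z
  proof -
    let ?p = "lact_perm X r z"
    have p: "?p permutes X" by (rule lact_perm_permutes[OF nd z])
    have "\<exists>t. (unit_vector y, t) \<in> \<phi> ` carrier ?G" if "y \<in> X" for y
      using subsetD[OF gen imageI[OF that]] unfolding generator_affine_def by blast
    then obtain m g where m: "m \<noteq> 0" and g: "g \<in> carrier ?G"
      and \<phi>g: "\<phi> g = (\<lambda>y. m * unit_vector x y, id)"
      using pure_translation_exists[OF assms(1) x img_is_subgroup] by force
    obtain h where h: "h \<in> carrier ?G" and \<phi>h: "\<phi> h = (unit_vector z, perm_inv ?p)"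
      using gen z by (auto simp: generator_affine_def)
    obtain n where "((\<lambda>u. group_commutator ?G u h) ^^ n) g = \<one>\<^bsub>?G\<^esub>"
      using assms(3) g h unfolding engel_group_def by blast
    then have "((\<lambda>u. group_commutator ?H u (unit_vector z, perm_inv ?p)) ^^ n)
        (\<lambda>y. m * unit_vector x y, id) = \<one>\<^bsub>?H\<^esub>"
      using hom_iterated_commutator[OF group_hom_axioms g h, of n] by (simp add: \<phi>g \<phi>h)
    then have zero: "((\<lambda>v y. v (?p y) - v y) ^^ n) (\<lambda>y. m * unit_vector x y) = (\<lambda>y. 0)"
      using iterated_commutator_translation[OF permutes_inv[OF p]]
      by (simp add: affine_perm_group_simps permutes_inv_inv[OF p])
    obtain d where "d > 0" "?p ^^ d = id"
      using permutation_is_nilpotent[of ?p] assms(1) p permutation_permutes by blast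
    \<comment> \<open>At \<open>x\<close> the invariance says that \<open>e\<^sub>x\<close> has coordinate 1 at \<open>\<sigma>\<^sub>z x\<close>.\<close>
    from iterated_difference_zero_imp_invariant[OF this zero, of x]
    have "?p x = x" using m by (simp add: unit_vector_def split: if_splits)
    then show ?thesis using x by (simp add: lact_perm_def)
  qed
  show ?thesis
    unfolding trivial_solution_def
  proof (intro ballI)
    fix x y assume xy: "x \<in> X" "y \<in> X"
    define b where "b = ract r x y"
    have rxy: "r (x, y) = (y, b)"
      using fixes_all[OF xy] by (simp add: b_def lact_def ract_def prod_eq_iff)
    have "r (x, y) \<in> X \<times> X"
      using assms(2) xy by (auto simp: ybe_solution_def set_theoretic_solution_def)
    then have b: "b \<in> X" using rxy by simp
    have "r (y, b) = (x, y)" using iv xy rxy by (force simp: involutive_def)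
    then have "b = x" using fixes_all[OF xy(2) b] by (simp add: lact_def)
    then show "r (x, y) = (y, x)" using rxy by simp
  qed
qed

end
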